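(* Let $d\ge 2$ be an integer and let $\alpha,\beta\in\mathbb{R}$. The linear map $\Phi_{\alpha,\beta}:M_d\to M_d$, $\Phi_{\alpha,\beta}=(1-\alpha-\beta)\,\mathcal{I}+\alpha\,\tau_0+\beta\,\Delta$, is: 1. positive if and only if $$0\le\alpha\le\frac{d}{d-1}\quad\text{and}\quad -\frac{2\alpha}{d}\le\beta\le\frac{d}{d-1}-\alpha;$$ 2. completely positive if and only if $$0\le\alpha\le\frac{d}{d-1}\quad\text{and}\quad -\frac{\alpha}{d}\le\beta\le\frac{d}{d-1}-\frac{d+1}{d}\,\alpha.$$
   Context: $M_d$ is the algebra of $d\times d$ complex matrices. $\mathcal{I}$ is the identity map on $M_d$, $\tau_0(X)=\frac{1}{d}(\operatorname{Tr}X)\,\mathbb{I}_d$ with $\mathbb{I}_d$ the identity matrix, and $\Delta(X)$ is the diagonal part of $X$ (the diagonal matrix with the same diagonal entries as $X$ in the standard basis). A linear map is positive if it sends positive semidefinite matrices to positive semidefinite matrices; it is completely positive if $\mathrm{id}_{M_n}\otimes\Phi$ is positive for all $n\ge1$. *)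

theory Defs
  imports "Jordan_Normal_Form.Schur_Decomposition"
begin

definition linear_mat_map :: "nat \<Rightarrow> (complex mat \<Rightarrow> complex mat) \<Rightarrow> bool" where
  "linear_mat_map d \<Phi> \<longleftrightarrow>
     (\<forall>X\<in>carrier_mat d d. \<Phi> X \<in> carrier_mat d d) \<and>
     (\<forall>X\<in>carrier_mat d d. \<forall>Y\<in>carrier_mat d d. \<Phi> (X + Y) = \<Phi> X + \<Phi> Y) \<and>
     (\<forall>c. \<forall>X\<in>carrier_mat d d. \<Phi> (c \<cdot>\<^sub>m X) = c \<cdot>\<^sub>m \<Phi> X)"

text \<open>The order on complex numbers is that of \<^theory>\<open>HOL-Library.Complex_Order\<close>: the quadratic form
  below is required to be real and nonnegative.\<close>

definition psd_mat :: "nat \<Rightarrow> complex mat \<Rightarrow> bool" where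
  "psd_mat n A \<longleftrightarrow> A \<in> carrier_mat n n \<and> mat_adjoint A = A \<and>
     (\<forall>v\<in>carrier_vec n. 0 \<le> (A *\<^sub>v v) \<bullet>c v)"

definition positive_map :: "nat \<Rightarrow> (complex mat \<Rightarrow> complex mat) \<Rightarrow> bool" where
  "positive_map d \<Phi> \<longleftrightarrow> linear_mat_map d \<Phi> \<and> (\<forall>X. psd_mat d X \<longrightarrow> psd_mat d (\<Phi> X))"

text \<open>The tensor product of square matrices, with the basis vector $e_i \otimes e_k$ of
  $\mathbb{C}^n \otimes \mathbb{C}^d$ numbered $i d + k$.\<close>

definition kron_mat :: "nat \<Rightarrow> nat \<Rightarrow> complex mat \<Rightarrow> complex mat \<Rightarrow> complex mat" where
  "kron_mat n d A B = mat (n * d) (n * d)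
     (\<lambda>(r, s). A $$ (r div d, s div d) * B $$ (r mod d, s mod d))"

definition mat_block :: "nat \<Rightarrow> complex mat \<Rightarrow> nat \<Rightarrow> nat \<Rightarrow> complex mat" where
  "mat_block d X i j = mat d d (\<lambda>(k, l). X $$ (i * d + k, j * d + l))"

text \<open>Writing $X = \sum_{i,j} E_{ij} \otimes X_{ij}$, the map $\mathrm{id}_{M_n} \otimes \Phi$ sends
  $X$ to $\sum_{i,j} E_{ij} \otimes \Phi(X_{ij})$, that is, it applies $\Phi$ to each of the
  $n^2$ blocks. The lemmas \<open>id_tensor_kron\<close> and \<open>linear_id_tensor\<close> below state that this is
  the linear map with $A \otimes B \mapsto A \otimes \Phi(B)$.\<close>

definition id_tensor :: "nat \<Rightarrow> nat \<Rightarrow> (complex mat \<Rightarrow> complex mat) \<Rightarrow> complex mat \<Rightarrow> complex mat" where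
  "id_tensor n d \<Phi> X = mat (n * d) (n * d)
     (\<lambda>(r, s). \<Phi> (mat_block d X (r div d) (s div d)) $$ (r mod d, s mod d))"

definition completely_positive_map :: "nat \<Rightarrow> (complex mat \<Rightarrow> complex mat) \<Rightarrow> bool" where
  "completely_positive_map d \<Phi> \<longleftrightarrow>
     linear_mat_map d \<Phi> \<and> (\<forall>n\<ge>1. positive_map (n * d) (id_tensor n d \<Phi>))"

definition mat_trace :: "complex mat \<Rightarrow> complex" where
  "mat_trace X = (\<Sum>i<dim_row X. X $$ (i, i))"

definition tau0 :: "nat \<Rightarrow> complex mat \<Rightarrow> complex mat" where
  "tau0 d X = (1 / of_nat d * mat_trace X) \<cdot>\<^sub>m 1\<^sub>m d"

definition diag_part :: "nat \<Rightarrow> complex mat \<Rightarrow> complex mat" where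
  "diag_part d X = mat_diag d (\<lambda>i. X $$ (i, i))"

definition Phi :: "nat \<Rightarrow> real \<Rightarrow> real \<Rightarrow> complex mat \<Rightarrow> complex mat" where
  "Phi d \<alpha> \<beta> X = complex_of_real (1 - \<alpha> - \<beta>) \<cdot>\<^sub>m X + complex_of_real \<alpha> \<cdot>\<^sub>m tau0 d X
     + complex_of_real \<beta> \<cdot>\<^sub>m diag_part d X"

lemma linear_Phi: "linear_mat_map d (Phi d \<alpha> \<beta>)"
  unfolding linear_mat_map_def
proof (intro conjI ballI allI)
  fix X Y :: "complex mat" and c :: complex
  assume X: "X \<in> carrier_mat d d"
  show "Phi d \<alpha> \<beta> X \<in> carrier_mat d d"
    using X by (simp add: Phi_def tau0_def diag_part_def)
  have "mat_trace (c \<cdot>\<^sub>m X) = c * mat_trace X"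
    using X by (auto simp: mat_trace_def sum_distrib_left)
  then show "Phi d \<alpha> \<beta> (c \<cdot>\<^sub>m X) = c \<cdot>\<^sub>m Phi d \<alpha> \<beta> X"
    using X by (intro eq_matI) (auto simp: Phi_def tau0_def diag_part_def mat_diag_def algebra_simps)
  assume Y: "Y \<in> carrier_mat d d"
  have "mat_trace (X + Y) = mat_trace X + mat_trace Y"
    using X Y by (auto simp: mat_trace_def sum.distrib)
  then show "Phi d \<alpha> \<beta> (X + Y) = Phi d \<alpha> \<beta> X + Phi d \<alpha> \<beta> Y"
    using X Y by (intro eq_matI)
      (auto simp: Phi_def tau0_def diag_part_def mat_diag_def algebra_simps add_divide_distrib)
qed

lemma block_index_less:
  fixes i k n d :: nat
  assumes "i < n" "k < d"
  shows "i * d + k < n * d"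
proof -
  have "i * d + k < Suc i * d" using assms by simp
  also have "\<dots> \<le> n * d" using assms by (intro mult_le_mono1) simp
  finally show ?thesis .
qed

lemma id_tensor_kron:
  assumes "linear_mat_map d \<Phi>" and B: "B \<in> carrier_mat d d"
  shows "id_tensor n d \<Phi> (kron_mat n d A B) = kron_mat n d A (\<Phi> B)"
proof (rule eq_matI)
  fix r s
  assume "r < dim_row (kron_mat n d A (\<Phi> B))" "s < dim_col (kron_mat n d A (\<Phi> B))"
  then have rs: "r < n * d" "s < n * d" by (auto simp: kron_mat_def)
  then have d: "0 < d" by (cases d) auto
  have lt: "r div d < n" "s div d < n" using rs by (auto simp: less_mult_imp_div_less)
  have "mat_block d (kron_mat n d A B) (r div d) (s div d) = A $$ (r div d, s div d) \<cdot>\<^sub>m B"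
    using B lt by (intro eq_matI) (auto simp: mat_block_def kron_mat_def block_index_less)
  moreover have "\<Phi> B \<in> carrier_mat d d" using assms by (auto simp: linear_mat_map_def)
  ultimately show "id_tensor n d \<Phi> (kron_mat n d A B) $$ (r, s) = kron_mat n d A (\<Phi> B) $$ (r, s)"
    using rs d assms by (auto simp: id_tensor_def kron_mat_def linear_mat_map_def)
qed (auto simp: id_tensor_def kron_mat_def)

lemma linear_id_tensor:
  assumes "linear_mat_map d \<Phi>"
  shows "linear_mat_map (n * d) (id_tensor n d \<Phi>)"
  unfolding linear_mat_map_def
proof (intro conjI ballI allI)
  fix X Y :: "complex mat" and c :: complex
  assume X: "X \<in> carrier_mat (n * d) (n * d)"
  show "id_tensor n d \<Phi> X \<in> carrier_mat (n * d) (n * d)" by (simp add: id_tensor_def)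
  have bl: "mat_block d Z i j \<in> carrier_mat d d" for Z i j by (simp add: mat_block_def)
  have ph: "\<Phi> (mat_block d Z i j) \<in> carrier_mat d d" for Z i j
    using assms bl by (auto simp: linear_mat_map_def)
  have ml: "r mod d < d" if "r < n * d" for r
    using that by (cases d) auto
  have "mat_block d (c \<cdot>\<^sub>m X) i j = c \<cdot>\<^sub>m mat_block d X i j" if "i < n" "j < n" for i j
    using X that by (intro eq_matI) (auto simp: mat_block_def block_index_less)
  then show "id_tensor n d \<Phi> (c \<cdot>\<^sub>m X) = c \<cdot>\<^sub>m id_tensor n d \<Phi> X"
    using assms bl ph[THEN carrier_matD(1)] ph[THEN carrier_matD(2)]
    by (intro eq_matI)
      (auto simp: id_tensor_def linear_mat_map_def less_mult_imp_div_less ml)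
  assume Y: "Y \<in> carrier_mat (n * d) (n * d)"
  have "mat_block d (X + Y) i j = mat_block d X i j + mat_block d Y i j" if "i < n" "j < n" for i j
    using X Y that by (intro eq_matI) (auto simp: mat_block_def block_index_less)
  then show "id_tensor n d \<Phi> (X + Y) = id_tensor n d \<Phi> X + id_tensor n d \<Phi> Y"
    using assms bl ph[THEN carrier_matD(1)] ph[THEN carrier_matD(2)]
    by (intro eq_matI)
      (auto simp: id_tensor_def linear_mat_map_def less_mult_imp_div_less ml)
qed

end

theory Submission
  imports Defs
begin

text \<open>Write $a = \alpha/d$ and $c = 1-\alpha-\beta$. At a vector $y$, the quadratic form of
  $(\mathrm{id}_{M_n} \otimes \Phi_{\alpha,\beta})(X)$ is $cP + aN + \beta S$ with $P$ the form of
  $X$ at $y$, $N$ the contribution of the trace and $S$ that of the diagonal part. For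
  positive semidefinite $X$ one has $N \ge S \ge 0$ and $dS \ge P \ge 0$, and for $n = 1$ also
  $N \ge P$ and $P + N \ge 2S$. Each of these inequalities is a sum of values of the
  form of $X$ at vectors $p \otimes e_k + q \otimes e_l$, and they imply $cP + aN + \beta S \ge 0$
  in the stated range. Conversely, rank one matrices $X$ show that the range cannot be enlarged:
  product vectors for positivity, the maximally entangled vector for complete positivity.\<close>

section \<open>Positive semidefiniteness in coordinates\<close>

lemma sum_lessThan_times:
  fixes f :: "nat \<Rightarrow> 'a :: comm_monoid_add"
  shows "(\<Sum>r<n * d. f r) = (\<Sum>i<n. \<Sum>k<d. f (i * d + k))"
proof -
  have "sum f {i * d..<i * d + d} = (\<Sum>k<d. f (i * d + k))" for i
    using sum.shift_bounds_nat_ivl[of f 0 "i * d" d] by (simp add: atLeast0LessThan add.commute)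
  then show ?thesis by (simp flip: sum.nat_group)
qed

lemma mat_adjoint_index:
  assumes "A \<in> carrier_mat n m" "i < m" "j < n"
  shows "mat_adjoint A $$ (i, j) = conjugate (A $$ (j, i))"
  using assms by (auto simp: mat_adjoint_def mat_of_rows_def)

text \<open>Test vectors become functions \<open>nat \<Rightarrow> complex\<close>, of which only
  the values below \<open>n\<close> enter, so that later witnesses can be plain lambda terms without
  carrier conditions.\<close>

lemma psd_mat_iff:
  "psd_mat n A \<longleftrightarrow> A \<in> carrier_mat n n \<and> (\<forall>r<n. \<forall>s<n. cnj (A $$ (r, s)) = A $$ (s, r)) \<and>
     (\<forall>v. 0 \<le> (\<Sum>r<n. \<Sum>s<n. cnj (v r) * A $$ (r, s) * v s))"
proof (cases "A \<in> carrier_mat n n")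
  case True
  have dims: "mat_adjoint A \<in> carrier_mat n n"
    using True by (auto simp: mat_adjoint_def)
  have adj: "mat_adjoint A = A \<longleftrightarrow> (\<forall>r<n. \<forall>s<n. cnj (A $$ (r, s)) = A $$ (s, r))"
  proof
    assume "mat_adjoint A = A"
    then show "\<forall>r<n. \<forall>s<n. cnj (A $$ (r, s)) = A $$ (s, r)"
      using mat_adjoint_index[OF True] by (metis conjugate_complex_def)
  next
    assume "\<forall>r<n. \<forall>s<n. cnj (A $$ (r, s)) = A $$ (s, r)"
    then show "mat_adjoint A = A"
      using True dims by (intro eq_matI) (auto simp: mat_adjoint_index[OF True])
  qed
  have form: "(A *\<^sub>v w) \<bullet>c w = (\<Sum>r<n. \<Sum>s<n. cnj (w $ r) * A $$ (r, s) * w $ s)"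
    if "w \<in> carrier_vec n" for w
    using True that
    by (auto simp: scalar_prod_def atLeast0LessThan sum_distrib_right sum_distrib_left mult_ac
        intro!: sum.cong)
  have "(\<forall>w\<in>carrier_vec n. 0 \<le> (A *\<^sub>v w) \<bullet>c w) \<longleftrightarrow>
    (\<forall>v. 0 \<le> (\<Sum>r<n. \<Sum>s<n. cnj (v r) * A $$ (r, s) * v s))" (is "?L \<longleftrightarrow> ?R")
  proof
    assume L: ?L
    show ?R
    proof
      fix v :: "nat \<Rightarrow> complex"
      show "0 \<le> (\<Sum>r<n. \<Sum>s<n. cnj (v r) * A $$ (r, s) * v s)"
        using L[rule_format, of "vec n v"] by (simp add: form)
    qed
  qed (simp add: form)
  with True adj show ?thesis by (simp add: psd_mat_def)
qed (simp add: psd_mat_def)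

text \<open>The sesquilinear form of $X$ at the pair $p \otimes e_k$, $q \otimes e_l$. A vector of
  $\mathbb{C}^n \otimes \mathbb{C}^d$ is represented as $\sum_k y_k \otimes e_k$, with the index of
  the second factor first.\<close>

definition slot_form ::
  "nat \<Rightarrow> nat \<Rightarrow> complex mat \<Rightarrow> nat \<Rightarrow> nat \<Rightarrow> (nat \<Rightarrow> complex) \<Rightarrow> (nat \<Rightarrow> complex) \<Rightarrow> complex" where
  "slot_form n d X k l p q = (\<Sum>i<n. \<Sum>j<n. cnj (p i) * X $$ (i * d + k, j * d + l) * q j)"

lemma slot_form_flat:
  "(\<Sum>r<n * d. \<Sum>s<n * d. cnj (v r) * X $$ (r, s) * v s) =
   (\<Sum>k<d. \<Sum>l<d. slot_form n d X k l (\<lambda>i. v (i * d + k)) (\<lambda>i. v (i * d + l)))"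
proof -
  have "(\<Sum>r<n * d. \<Sum>s<n * d. cnj (v r) * X $$ (r, s) * v s) =
    (\<Sum>i<n. \<Sum>k<d. \<Sum>j<n. \<Sum>l<d. cnj (v (i * d + k)) * X $$ (i * d + k, j * d + l) * v (j * d + l))"
    by (simp add: sum_lessThan_times)
  also have "\<dots> = (\<Sum>k<d. \<Sum>i<n. \<Sum>l<d. \<Sum>j<n.
      cnj (v (i * d + k)) * X $$ (i * d + k, j * d + l) * v (j * d + l))"
    by (subst sum.swap) (intro sum.cong refl sum.swap)
  also have "\<dots> = (\<Sum>k<d. \<Sum>l<d. \<Sum>i<n. \<Sum>j<n.
      cnj (v (i * d + k)) * X $$ (i * d + k, j * d + l) * v (j * d + l))"
    by (intro sum.cong refl sum.swap)
  finally show ?thesis by (simp add: slot_form_def)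
qed

text \<open>The index \<open>r\<close> splits uniquely as \<open>i * d + k\<close>, so every family
  \<open>y\<close> comes from the flat vector with entries \<open>y (r mod d) (r div d)\<close>, and
  conversely.\<close>

lemma psd_mat_slot_iff:
  "psd_mat (n * d) X \<longleftrightarrow> X \<in> carrier_mat (n * d) (n * d) \<and>
     (\<forall>r<n * d. \<forall>s<n * d. cnj (X $$ (r, s)) = X $$ (s, r)) \<and>
     (\<forall>y. 0 \<le> (\<Sum>k<d. \<Sum>l<d. slot_form n d X k l (y k) (y l)))"
proof -
  have "0 \<le> (\<Sum>k<d. \<Sum>l<d. slot_form n d X k l (y k) (y l))"
    if "\<forall>v. 0 \<le> (\<Sum>r<n * d. \<Sum>s<n * d. cnj (v r) * X $$ (r, s) * v s)" for y
  proof -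
    have "slot_form n d X k l (\<lambda>i. y ((i * d + k) mod d) ((i * d + k) div d))
        (\<lambda>i. y ((i * d + l) mod d) ((i * d + l) div d)) = slot_form n d X k l (y k) (y l)"
      if "k < d" "l < d" for k l
      using that by simp
    then show ?thesis
      using that[rule_format, of "\<lambda>r. y (r mod d) (r div d)"]
      unfolding slot_form_flat by simp
  qed
  then have "(\<forall>v. 0 \<le> (\<Sum>r<n * d. \<Sum>s<n * d. cnj (v r) * X $$ (r, s) * v s)) \<longleftrightarrow>
      (\<forall>y. 0 \<le> (\<Sum>k<d. \<Sum>l<d. slot_form n d X k l (y k) (y l)))"
    by (auto simp: slot_form_flat)
  then show ?thesis
    by (simp add: psd_mat_iff)
qed

text \<open>This is the form of \<open>X\<close> at p \<otimes> e_k + q \<otimes> e_l, expanded by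
  sesquilinearity. All inequalities between P, N and S below come from it.\<close>

lemma psd_mat_two_slots:
  assumes "psd_mat (n * d) X" and "k < d" "l < d"
  shows "0 \<le> slot_form n d X k k p p + slot_form n d X k l p q +
    slot_form n d X l k q p + slot_form n d X l l q q"
proof -
  \<comment> \<open>The two contributions are added rather than chosen by a nested conditional, so
    that k = l is covered as well, with p + q in that slot.\<close>
  define y where "y m i = (if m = k then p i else 0) + (if m = l then q i else 0)" for m i
  have "slot_form n d X m m' (y m) (y m') =
      (if m = k then if m' = k then slot_form n d X k k p p else 0 else 0) +
      (if m = k then if m' = l then slot_form n d X k l p q else 0 else 0) +
      (if m = l then if m' = k then slot_form n d X l k q p else 0 else 0) +
      (if m = l then if m' = l then slot_form n d X l l q q else 0 else 0)" for m m'
    by (simp add: slot_form_def y_def algebra_simps sum.distrib)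
  moreover have "(\<Sum>m<d. \<Sum>m'<d. if m = k' then if m' = l' then z else 0 else 0) = z"
    if "k' < d" "l' < d" for k' l' and z :: complex
  proof -
    have "(\<Sum>m'<d. if m = k' then if m' = l' then z else 0 else 0) = (if m = k' then z else 0)" for m
      using that by simp
    then show ?thesis using that by simp
  qed
  ultimately have "(\<Sum>m<d. \<Sum>m'<d. slot_form n d X m m' (y m) (y m')) =
      slot_form n d X k k p p + slot_form n d X k l p q +
      slot_form n d X l k q p + slot_form n d X l l q q"
    using assms by (simp add: sum.distrib)
  then show ?thesis
    using assms(1)[unfolded psd_mat_slot_iff, THEN conjunct2, THEN conjunct2, THEN spec, of y]
    by simp
qed

lemma psd_mat_one_slot:
  assumes "psd_mat (n * d) X" "k < d"
  shows "0 \<le> slot_form n d X k k p p"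
  using psd_mat_two_slots[OF assms(1) assms(2) assms(2), of p "\<lambda>_. 0"]
  by (simp add: slot_form_def)

section \<open>The quadratic form of the image\<close>

lemma id_tensor_Phi_index:
  assumes "X \<in> carrier_mat (n * d) (n * d)" "i < n" "j < n" "k < d" "l < d"
  shows "id_tensor n d (Phi d \<alpha> \<beta>) X $$ (i * d + k, j * d + l) =
    of_real (1 - \<alpha> - \<beta>) * X $$ (i * d + k, j * d + l) +
    (if k = l then of_real (\<alpha> / d) * (\<Sum>m<d. X $$ (i * d + m, j * d + m)) +
       of_real \<beta> * X $$ (i * d + k, j * d + k) else 0)"
  using assms
  by (auto simp: id_tensor_def block_index_less Phi_def tau0_def diag_part_def mat_diag_def
      mat_block_def mat_trace_def)

text \<open>The three sums are P, N and S. Both \<open>tau0\<close> and \<open>diag_part\<close>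
  yield diagonal matrices on each block, so they contribute only where k = l.\<close>

lemma slot_form_id_tensor_Phi:
  assumes X: "X \<in> carrier_mat (n * d) (n * d)"
  shows "(\<Sum>k<d. \<Sum>l<d. slot_form n d (id_tensor n d (Phi d \<alpha> \<beta>) X) k l (y k) (y l)) =
    of_real (1 - \<alpha> - \<beta>) * (\<Sum>k<d. \<Sum>l<d. slot_form n d X k l (y k) (y l)) +
    of_real (\<alpha> / d) * (\<Sum>k<d. \<Sum>m<d. slot_form n d X m m (y k) (y k)) +
    of_real \<beta> * (\<Sum>k<d. slot_form n d X k k (y k) (y k))"
proof -
  have *: "slot_form n d (id_tensor n d (Phi d \<alpha> \<beta>) X) k l p q =
      of_real (1 - \<alpha> - \<beta>) * slot_form n d X k l p q +
      (if k = l then of_real (\<alpha> / d) * (\<Sum>m<d. slot_form n d X m m p q) +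
         of_real \<beta> * slot_form n d X k k p q else 0)" if "k < d" "l < d" for k l p q
  proof -
    \<comment> \<open>\<open>T\<close> is the partial trace of \<open>X\<close> over the second
      factor: its entry (i, j) is the trace of the block (i, j).\<close>
    define T where "T i j = (\<Sum>m<d. X $$ (i * d + m, j * d + m))" for i j
    have "(\<Sum>m<d. slot_form n d X m m p q) =
        (\<Sum>i<n. \<Sum>m<d. \<Sum>j<n. cnj (p i) * X $$ (i * d + m, j * d + m) * q j)"
      unfolding slot_form_def by (rule sum.swap)
    also have "\<dots> = (\<Sum>i<n. \<Sum>j<n. \<Sum>m<d. cnj (p i) * X $$ (i * d + m, j * d + m) * q j)"
      by (intro sum.cong refl sum.swap)
    finally have tr: "(\<Sum>m<d. slot_form n d X m m p q) = (\<Sum>i<n. \<Sum>j<n. cnj (p i) * T i j * q j)"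
      by (simp add: T_def sum_distrib_left sum_distrib_right)
    have idx: "id_tensor n d (Phi d \<alpha> \<beta>) X $$ (i * d + k, j * d + l) =
        of_real (1 - \<alpha> - \<beta>) * X $$ (i * d + k, j * d + l) +
        (if k = l then of_real (\<alpha> / d) * T i j + of_real \<beta> * X $$ (i * d + k, j * d + k) else 0)"
      if "i < n" "j < n" for i j
      unfolding T_def using X that \<open>k < d\<close> \<open>l < d\<close> by (rule id_tensor_Phi_index)
    have "slot_form n d (id_tensor n d (Phi d \<alpha> \<beta>) X) k l p q = (\<Sum>i<n. \<Sum>j<n.
        of_real (1 - \<alpha> - \<beta>) * (cnj (p i) * X $$ (i * d + k, j * d + l) * q j) +
        (if k = l then of_real (\<alpha> / d) * (cnj (p i) * T i j * q j) +
           of_real \<beta> * (cnj (p i) * X $$ (i * d + k, j * d + k) * q j) else 0))"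
      unfolding slot_form_def
      by (intro sum.cong refl, simp only: idx lessThan_iff) (simp add: algebra_simps)
    then show ?thesis
      unfolding tr
      by (cases "k = l")
        (simp_all only: slot_form_def sum.distrib sum_distrib_left simp_thms if_True if_False
          add_0_right)
  qed
  have "(\<Sum>l<d. slot_form n d (id_tensor n d (Phi d \<alpha> \<beta>) X) k l (y k) (y l)) =
      of_real (1 - \<alpha> - \<beta>) * (\<Sum>l<d. slot_form n d X k l (y k) (y l)) +
      (of_real (\<alpha> / d) * (\<Sum>m<d. slot_form n d X m m (y k) (y k)) +
       of_real \<beta> * slot_form n d X k k (y k) (y k))" if "k < d" for k
    using that by (simp add: * sum.distrib sum_distrib_left)
  then show ?thesis
    by (simp add: sum.distrib sum_distrib_left)
qed

lemma id_tensor_Phi_hermitian: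
  assumes X: "psd_mat (n * d) X" and rs: "r < n * d" "s < n * d"
  shows "cnj (id_tensor n d (Phi d \<alpha> \<beta>) X $$ (r, s)) = id_tensor n d (Phi d \<alpha> \<beta>) X $$ (s, r)"
proof -
  have d: "0 < d" using rs by (cases d) auto
  have Xc: "X \<in> carrier_mat (n * d) (n * d)"
    and herm: "\<And>r s. r < n * d \<Longrightarrow> s < n * d \<Longrightarrow> cnj (X $$ (r, s)) = X $$ (s, r)"
    using X unfolding psd_mat_iff by auto
  have "cnj (id_tensor n d (Phi d \<alpha> \<beta>) X $$ (i * d + k, j * d + l)) =
      id_tensor n d (Phi d \<alpha> \<beta>) X $$ (j * d + l, i * d + k)"
    if "i < n" "j < n" "k < d" "l < d" for i j k l
    using that by (auto simp: id_tensor_Phi_index[OF Xc] herm block_index_less)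
  from this[of "r div d" "s div d" "r mod d" "s mod d"] show ?thesis
    using rs d by (simp add: less_mult_imp_div_less)
qed

text \<open>Linearity and self-adjointness of the image hold for all real parameters, so positivity
  comes down to cP + aN + \<beta>S \<ge> 0.\<close>

lemma positive_id_tensor_PhiI:
  assumes "\<And>X y. psd_mat (n * d) X \<Longrightarrow>
    0 \<le> of_real (1 - \<alpha> - \<beta>) * (\<Sum>k<d. \<Sum>l<d. slot_form n d X k l (y k) (y l)) +
      of_real (\<alpha> / d) * (\<Sum>k<d. \<Sum>m<d. slot_form n d X m m (y k) (y k)) +
      of_real \<beta> * (\<Sum>k<d. slot_form n d X k k (y k) (y k))"
  shows "positive_map (n * d) (id_tensor n d (Phi d \<alpha> \<beta>))"
  unfolding positive_map_def
proof (intro conjI allI impI)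
  show "linear_mat_map (n * d) (id_tensor n d (Phi d \<alpha> \<beta>))"
    by (intro linear_id_tensor linear_Phi)
  fix X assume X: "psd_mat (n * d) X"
  then have Xc: "X \<in> carrier_mat (n * d) (n * d)" by (simp add: psd_mat_def)
  show "psd_mat (n * d) (id_tensor n d (Phi d \<alpha> \<beta>) X)"
    unfolding psd_mat_slot_iff slot_form_id_tensor_Phi[OF Xc]
    using assms[OF X] id_tensor_Phi_hermitian[OF X] by (auto simp: id_tensor_def)
qed

section \<open>Rank one test matrices\<close>

text \<open>This is x x^T for x = \<Sum> x_k \<otimes> e_k, with the slot index first as in
  \<open>slot_form\<close>. Real vectors suffice to detect every boundary of the two parameter
  ranges.\<close>

definition real_rank_one :: "nat \<Rightarrow> nat \<Rightarrow> (nat \<Rightarrow> nat \<Rightarrow> real) \<Rightarrow> complex mat" where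
  "real_rank_one n d x = mat (n * d) (n * d)
     (\<lambda>(r, s). of_real (x (r mod d) (r div d) * x (s mod d) (s div d)))"

lemma slot_form_real_rank_one:
  assumes "k < d" "l < d"
  shows "slot_form n d (real_rank_one n d x) k l p q =
    cnj (\<Sum>i<n. of_real (x k i) * p i) * (\<Sum>j<n. of_real (x l j) * q j)"
proof -
  have idx: "real_rank_one n d x $$ (i * d + k, j * d + l) = of_real (x k i * x l j)"
    if "i < n" "j < n" for i j
    using assms that by (simp add: real_rank_one_def block_index_less)
  show ?thesis
    unfolding slot_form_def cnj_sum sum_product
    by (intro sum.cong refl, simp only: idx lessThan_iff) (simp add: mult_ac)
qed

text \<open>The form at y is the squared modulus of the pairing of x with y.\<close>

lemma psd_real_rank_one: "psd_mat (n * d) (real_rank_one n d x)"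
proof -
  have "0 \<le> (\<Sum>k<d. \<Sum>l<d. slot_form n d (real_rank_one n d x) k l (y k) (y l))" for y
  proof -
    define z where "z = (\<Sum>k<d. \<Sum>i<n. of_real (x k i) * y k i)"
    have "(\<Sum>k<d. \<Sum>l<d. slot_form n d (real_rank_one n d x) k l (y k) (y l)) = cnj z * z"
      by (simp add: slot_form_real_rank_one z_def sum_product)
    also have "\<dots> = of_real ((cmod z)\<^sup>2)"
      by (simp only: complex_norm_square mult.commute)
    finally show ?thesis
      by (simp add: less_eq_complex_def del: of_real_power)
  qed
  then show ?thesis
    unfolding psd_mat_slot_iff by (auto simp: real_rank_one_def mult.commute)
qed

text \<open>On x x^T every slot form is a product of two pairings, so P, N and S become squares or
  sums of squares of pairings of x with y.\<close>

lemma positive_id_tensor_PhiD: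
  fixes x y :: "nat \<Rightarrow> nat \<Rightarrow> real"
  assumes "positive_map (n * d) (id_tensor n d (Phi d \<alpha> \<beta>))"
  shows "0 \<le> (1 - \<alpha> - \<beta>) * (\<Sum>k<d. \<Sum>i<n. x k i * y k i)\<^sup>2 +
    \<alpha> / d * (\<Sum>k<d. \<Sum>m<d. (\<Sum>i<n. x m i * y k i)\<^sup>2) + \<beta> * (\<Sum>k<d. (\<Sum>i<n. x k i * y k i)\<^sup>2)"
    (is "0 \<le> ?r")
proof -
  let ?X = "real_rank_one n d x" and ?y = "\<lambda>k i. complex_of_real (y k i)"
  have X: "psd_mat (n * d) ?X" by (rule psd_real_rank_one)
  have Xc: "?X \<in> carrier_mat (n * d) (n * d)" by (simp add: real_rank_one_def)
  have sf: "slot_form n d ?X k l (?y a) (?y b) =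
      of_real ((\<Sum>i<n. x k i * y a i) * (\<Sum>i<n. x l i * y b i))" if "k < d" "l < d" for k l a b
    using that by (simp add: slot_form_real_rank_one)
  have "psd_mat (n * d) (id_tensor n d (Phi d \<alpha> \<beta>) ?X)"
    using assms X unfolding positive_map_def by blast
  then have "\<forall>y. 0 \<le> (\<Sum>k<d. \<Sum>l<d. slot_form n d (id_tensor n d (Phi d \<alpha> \<beta>) ?X) k l (y k) (y l))"
    unfolding psd_mat_slot_iff by blast
  from this[rule_format, of ?y]
  have "0 \<le> (\<Sum>k<d. \<Sum>l<d. slot_form n d (id_tensor n d (Phi d \<alpha> \<beta>) ?X) k l (?y k) (?y l))" .
  also have "\<dots> = of_real ?r"
    unfolding slot_form_id_tensor_Phi[OF Xc]
    by (simp add: sf power2_eq_square sum_product)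
  finally show ?thesis by (simp add: less_eq_complex_def)
qed

text \<open>For n = 1 the only block is the matrix itself. Positivity and complete positivity can
  thus share the formulas for P, N and S.\<close>

lemma positive_Phi_iff_id_tensor:
  "positive_map d (Phi d \<alpha> \<beta>) \<longleftrightarrow> positive_map (1 * d) (id_tensor 1 d (Phi d \<alpha> \<beta>))"
proof -
  have "id_tensor 1 d (Phi d \<alpha> \<beta>) X = Phi d \<alpha> \<beta> X" if X: "X \<in> carrier_mat d d" for X
  proof -
    have "mat_block d X 0 0 = X"
      using X by (intro eq_matI) (auto simp: mat_block_def)
    moreover have "Phi d \<alpha> \<beta> X \<in> carrier_mat d d"
      using linear_Phi X unfolding linear_mat_map_def by blast
    ultimately show ?thesis
      by (intro eq_matI) (auto simp: id_tensor_def)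
  qed
  then show ?thesis
    using linear_id_tensor[OF linear_Phi, of 1 d \<alpha> \<beta>] linear_Phi[of d \<alpha> \<beta>]
    unfolding positive_map_def psd_mat_def by auto
qed

section \<open>Inequalities between P, N and S\<close>

text \<open>A Cauchy-Schwarz inequality: the values of the form at y_k \<otimes> e_k - y_l \<otimes>
  e_l, summed over all k and l, give 2(dS - P).\<close>

lemma diag_form_ge_form:
  assumes X: "psd_mat (n * d) X"
  shows "(\<Sum>k<d. \<Sum>l<d. slot_form n d X k l (y k) (y l)) \<le>
    of_nat d * (\<Sum>k<d. slot_form n d X k k (y k) (y k))"
proof -
  have "0 \<le> (\<Sum>k<d. \<Sum>l<d. slot_form n d X k k (y k) (y k) - slot_form n d X k l (y k) (y l) -
      slot_form n d X l k (y l) (y k) + slot_form n d X l l (y l) (y l))"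
  proof (intro sum_nonneg)
    fix k l assume "k \<in> {..<d}" "l \<in> {..<d}"
    then show "0 \<le> slot_form n d X k k (y k) (y k) - slot_form n d X k l (y k) (y l) -
        slot_form n d X l k (y l) (y k) + slot_form n d X l l (y l) (y l)"
      using psd_mat_two_slots[OF X, of k l "y k" "\<lambda>i. - y l i"]
      by (simp add: slot_form_def sum_negf)
  qed
  also have "\<dots> = 2 * (of_nat d * (\<Sum>k<d. slot_form n d X k k (y k) (y k)) -
      (\<Sum>k<d. \<Sum>l<d. slot_form n d X k l (y k) (y l)))"
    using sum.swap[of "\<lambda>k l. slot_form n d X l k (y l) (y k)" "{..<d}" "{..<d}"]
    by (simp add: sum.distrib sum_subtractf sum_distrib_left algebra_simps)
  finally show ?thesis
    by (auto simp: less_eq_complex_def)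
qed

text \<open>S collects the terms of N with m = k, and the other terms of N are nonnegative.\<close>

lemma diag_form_le_trace_form:
  assumes X: "psd_mat (n * d) X"
  shows "(\<Sum>k<d. slot_form n d X k k (y k) (y k)) \<le>
    (\<Sum>k<d. \<Sum>m<d. slot_form n d X m m (y k) (y k))"
proof (rule sum_mono)
  fix k assume k: "k \<in> {..<d}"
  show "slot_form n d X k k (y k) (y k) \<le> (\<Sum>m<d. slot_form n d X m m (y k) (y k))"
    using psd_mat_one_slot[OF X] k
    by (intro member_le_sum[where f = "\<lambda>m. slot_form n d X m m (y k) (y k)"]) auto
qed

text \<open>For $n = 1$ one also has the vectors whose coefficients are the conjugates of those of $y$
  with the positions $k$ and $l$ exchanged.\<close>

lemma form_le_trace_form:
  assumes X: "psd_mat (1 * d) X"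
  shows "(\<Sum>k<d. \<Sum>l<d. slot_form 1 d X k l (y k) (y l)) \<le>
    (\<Sum>k<d. \<Sum>m<d. slot_form 1 d X m m (y k) (y k))"
proof -
  \<comment> \<open>For n = 1 the coefficients are scalars: conjugating and exchanging them leaves
    the mixed terms of the form unchanged, but pairs slot k with the coefficient y_l. The diagonal
    terms therefore sum to N instead of S.\<close>
  have "0 \<le> (\<Sum>k<d. \<Sum>l<d. slot_form 1 d X k k (y l) (y l) - slot_form 1 d X k l (y k) (y l) -
      slot_form 1 d X l k (y l) (y k) + slot_form 1 d X l l (y k) (y k))"
  proof (intro sum_nonneg)
    fix k l assume "k \<in> {..<d}" "l \<in> {..<d}"
    then show "0 \<le> slot_form 1 d X k k (y l) (y l) - slot_form 1 d X k l (y k) (y l) -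
        slot_form 1 d X l k (y l) (y k) + slot_form 1 d X l l (y k) (y k)"
      using psd_mat_two_slots[OF X, of k l "\<lambda>i. cnj (y l i)" "\<lambda>i. - cnj (y k i)"]
      by (simp add: slot_form_def mult_ac)
  qed
  also have "\<dots> = 2 * ((\<Sum>k<d. \<Sum>m<d. slot_form 1 d X m m (y k) (y k)) -
      (\<Sum>k<d. \<Sum>l<d. slot_form 1 d X k l (y k) (y l)))"
    using sum.swap[of "\<lambda>k l. slot_form 1 d X l k (y l) (y k)" "{..<d}" "{..<d}"]
      sum.swap[of "\<lambda>k l. slot_form 1 d X k k (y l) (y l)" "{..<d}" "{..<d}"]
    by (simp add: sum.distrib sum_subtractf algebra_simps)
  finally show ?thesis
    by (auto simp: less_eq_complex_def)
qed

text \<open>With a plus sign the exchanged vectors have total form 2(P + N). The terms with k = l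
  alone contribute 4S, and the remaining ones are nonnegative.\<close>

lemma two_diag_form_le:
  assumes X: "psd_mat (1 * d) X"
  shows "2 * (\<Sum>k<d. slot_form 1 d X k k (y k) (y k)) \<le>
    (\<Sum>k<d. \<Sum>l<d. slot_form 1 d X k l (y k) (y l)) +
    (\<Sum>k<d. \<Sum>m<d. slot_form 1 d X m m (y k) (y k))"
proof -
  define h where "h k l = slot_form 1 d X k k (y l) (y l) + slot_form 1 d X k l (y k) (y l) +
      slot_form 1 d X l k (y l) (y k) + slot_form 1 d X l l (y k) (y k)" for k l
  have nonneg: "0 \<le> h k l" if "k < d" "l < d" for k l
    using psd_mat_two_slots[OF X that, of "\<lambda>i. cnj (y l i)" "\<lambda>i. cnj (y k i)"]
    by (simp add: h_def slot_form_def mult_ac)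
  have "4 * (\<Sum>k<d. slot_form 1 d X k k (y k) (y k)) = (\<Sum>k<d. h k k)"
    by (simp add: h_def sum_distrib_left)
  also have "\<dots> \<le> (\<Sum>k<d. \<Sum>l<d. h k l)"
  proof (rule sum_mono)
    fix k assume "k \<in> {..<d}"
    then show "h k k \<le> (\<Sum>l<d. h k l)"
      using nonneg by (intro member_le_sum[where f = "h k"]) auto
  qed
  also have "\<dots> = 2 * ((\<Sum>k<d. \<Sum>l<d. slot_form 1 d X k l (y k) (y l)) +
      (\<Sum>k<d. \<Sum>m<d. slot_form 1 d X m m (y k) (y k)))"
    unfolding h_def
    using sum.swap[of "\<lambda>k l. slot_form 1 d X l k (y l) (y k)" "{..<d}" "{..<d}"]
      sum.swap[of "\<lambda>k l. slot_form 1 d X k k (y l) (y l)" "{..<d}" "{..<d}"]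
    by (simp add: sum.distrib algebra_simps)
  finally show ?thesis
    by (auto simp: less_eq_complex_def)
qed

section \<open>The range of positivity\<close>

lemma sum_eq_first_two:
  fixes f :: "nat \<Rightarrow> real"
  assumes "2 \<le> d" "\<And>k. 2 \<le> k \<Longrightarrow> f k = 0"
  shows "(\<Sum>k<d. f k) = f 0 + f 1"
proof -
  have "(\<Sum>k<d. f k) = (\<Sum>k<2. f k)"
    using assms by (intro sum.mono_neutral_right) auto
  then show ?thesis by (simp add: numeral_2_eq_2)
qed

text \<open>Each condition is the form of the image of x x^T at y, up to a positive factor, for one
  pair of real vectors x and y.\<close>

lemma positive_Phi_necessary:
  assumes d: "2 \<le> d" and pos: "positive_map d (Phi d \<alpha> \<beta>)"
  shows "0 \<le> \<alpha>" "0 \<le> 2 * \<alpha> / d + \<beta>" "0 \<le> 1 - \<alpha> + \<alpha> / d"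
    "0 \<le> 1 - \<alpha> - \<beta> + \<alpha> / d + \<beta> / d"
proof -
  have form: "0 \<le> (1 - \<alpha> - \<beta>) * (\<Sum>k<d. x k * y k)\<^sup>2 +
      \<alpha> / d * ((\<Sum>k<d. (y k)\<^sup>2) * (\<Sum>m<d. (x m)\<^sup>2)) + \<beta> * (\<Sum>k<d. (x k * y k)\<^sup>2)"
    for x y :: "nat \<Rightarrow> real"
  proof -
    have "(\<Sum>k<d. \<Sum>m<d. (x m * y k)\<^sup>2) = (\<Sum>k<d. (y k)\<^sup>2) * (\<Sum>m<d. (x m)\<^sup>2)"
      unfolding sum_product power_mult_distrib by (simp add: mult.commute)
    then show ?thesis
      using positive_id_tensor_PhiD[OF pos[unfolded positive_Phi_iff_id_tensor],
          of "\<lambda>k _. x k" "\<lambda>k _. y k"]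
      by simp
  qed
  \<comment> \<open>For x = e_0 and y = e_1 both P and S vanish and N = 1.\<close>
  show "0 \<le> \<alpha>"
    using form[of "\<lambda>k. of_bool (k = 0)" "\<lambda>k. of_bool (k = 1)"] d
    by (simp add: sum_eq_first_two zero_le_divide_iff del: sum_of_bool_eq)
  \<comment> \<open>The vectors e_0 + e_1 and e_0 - e_1 are orthogonal, which removes P, while N = 4
    and S = 2.\<close>
  have "0 \<le> 2 * (2 * \<alpha> / d + \<beta>)"
    using form[of "\<lambda>k. if k < 2 then 1 else 0" "\<lambda>k. if k = 0 then 1 else if k = 1 then - 1 else 0"] d
    by (simp add: sum_eq_first_two algebra_simps)
  then show "0 \<le> 2 * \<alpha> / d + \<beta>"
    by simp
  show "0 \<le> 1 - \<alpha> + \<alpha> / d"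
    using form[of "\<lambda>k. of_bool (k = 0)" "\<lambda>k. of_bool (k = 0)"] d
    by (simp add: sum_eq_first_two del: sum_of_bool_eq)
  \<comment> \<open>With x and y both the all-ones vector, P = N = d^2 and S = d, the case of
    equality in P \<le> dS.\<close>
  have "0 \<le> (1 - \<alpha> - \<beta> + \<alpha> / d + \<beta> / d) * (real d)\<^sup>2"
  proof -
    have "(1 - \<alpha> - \<beta> + \<alpha> / d + \<beta> / d) * (real d)\<^sup>2 =
        (1 - \<alpha> - \<beta>) * (real d)\<^sup>2 + \<alpha> / d * (real d * real d) + \<beta> * real d"
      using d by (simp add: power2_eq_square field_simps)
    then show ?thesis
      using form[of "\<lambda>_. 1" "\<lambda>_. 1"] by simp
  qed
  then show "0 \<le> 1 - \<alpha> - \<beta> + \<alpha> / d + \<beta> / d"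
    using d by (simp add: zero_le_mult_iff)
qed

lemma positive_Phi_sufficient:
  assumes d: "2 \<le> d" and \<alpha>: "0 \<le> \<alpha>" and \<beta>: "0 \<le> 2 * \<alpha> / d + \<beta>"
    and diag: "0 \<le> 1 - \<alpha> + \<alpha> / d" and flat: "0 \<le> 1 - \<alpha> - \<beta> + \<alpha> / d + \<beta> / d"
  shows "positive_map d (Phi d \<alpha> \<beta>)"
  unfolding positive_Phi_iff_id_tensor
proof (rule positive_id_tensor_PhiI)
  fix X and y :: "nat \<Rightarrow> nat \<Rightarrow> complex"
  assume X: "psd_mat (1 * d) X"
  define P where "P = (\<Sum>k<d. \<Sum>l<d. slot_form 1 d X k l (y k) (y l))"
  define N where "N = (\<Sum>k<d. \<Sum>m<d. slot_form 1 d X m m (y k) (y k))"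
  define S where "S = (\<Sum>k<d. slot_form 1 d X k k (y k) (y k))"
  have "0 \<le> P" using X unfolding P_def psd_mat_slot_iff by blast
  moreover have "0 \<le> S" unfolding S_def using psd_mat_one_slot[OF X] by (intro sum_nonneg) auto
  moreover have "P \<le> of_nat d * S" unfolding P_def S_def by (rule diag_form_ge_form[OF X])
  moreover have "P \<le> N" unfolding P_def N_def by (rule form_le_trace_form[OF X])
  moreover have "2 * S \<le> P + N" unfolding P_def S_def N_def by (rule two_diag_form_le[OF X])
  \<comment> \<open>In the order on complex numbers comparable elements have equal imaginary parts,
    so the inequalities also make P, N and S real.\<close>
  ultimately have le: "0 \<le> Re P" "Re P \<le> d * Re S" "Re P \<le> Re N" "2 * Re S \<le> Re P + Re N"
    and im: "Im P = 0" "Im S = 0" "Im N = 0"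
    by (auto simp: less_eq_complex_def)
  have "0 \<le> (1 - \<alpha> - \<beta>) * Re P + \<alpha> / d * Re N + \<beta> * Re S"
  proof (cases "0 \<le> \<beta>")
    \<comment> \<open>Here N \<ge> P and S \<ge> P/d bound the form below by (c + a +
      \<beta>/d)P.\<close>
    case True
    have "0 \<le> (1 - \<alpha> - \<beta> + \<alpha> / d + \<beta> / d) * Re P"
      using flat le by simp
    moreover have "\<alpha> / d * Re P \<le> \<alpha> / d * Re N"
      using \<alpha> le by (intro mult_left_mono) auto
    moreover have "\<beta> / d * Re P \<le> \<beta> * Re S"
      using mult_left_mono[OF le(2) True] d by (simp add: field_simps)
    ultimately show ?thesis by (simp add: algebra_simps)
  next
    \<comment> \<open>Now S needs an upper bound: S \<le> (P + N)/2 leaves (c + \<beta>/2)P + (a +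
      \<beta>/2)N. As a + \<beta>/2 \<ge> 0, N may be replaced by P, giving (c + a +
      \<beta>)P.\<close>
    case False
    have "0 \<le> (1 - \<alpha> + \<alpha> / d) * Re P"
      using diag le by simp
    moreover have "(\<alpha> / d + \<beta> / 2) * Re P \<le> (\<alpha> / d + \<beta> / 2) * Re N"
      using \<beta> le by (intro mult_left_mono) auto
    moreover have "\<beta> / 2 * (Re P + Re N) \<le> \<beta> / 2 * (2 * Re S)"
      using False le by (intro mult_left_mono_neg) auto
    ultimately show ?thesis by (simp add: algebra_simps)
  qed
  then show "0 \<le> of_real (1 - \<alpha> - \<beta>) * (\<Sum>k<d. \<Sum>l<d. slot_form 1 d X k l (y k) (y l)) +
      of_real (\<alpha> / d) * (\<Sum>k<d. \<Sum>m<d. slot_form 1 d X m m (y k) (y k)) +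
      of_real \<beta> * (\<Sum>k<d. slot_form 1 d X k k (y k) (y k))"
    using im unfolding less_eq_complex_def P_def[symmetric] N_def[symmetric] S_def[symmetric]
    by simp
qed

section \<open>The range of complete positivity\<close>

text \<open>Taking n = d and x = \<Sum> e_k \<otimes> e_k, the unnormalized maximally entangled
  vector, turns the image into the Choi matrix of the map. Its form at y is c(tr y)^2 plus
  \<open>a\<close> times the sum of all squared entries plus \<beta> times that of the diagonal
  ones.\<close>

lemma completely_positive_Phi_necessary:
  assumes d: "2 \<le> d" and cp: "completely_positive_map d (Phi d \<alpha> \<beta>)"
  shows "0 \<le> \<alpha>" "0 \<le> \<alpha> / d + \<beta>" "0 \<le> (1 - \<alpha> - \<beta>) * d + \<alpha> / d + \<beta>"
proof -
  have pos: "positive_map (d * d) (id_tensor d d (Phi d \<alpha> \<beta>))"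
    using cp d unfolding completely_positive_map_def by auto
  have form: "0 \<le> (1 - \<alpha> - \<beta>) * (\<Sum>k<d. y k k)\<^sup>2 +
      \<alpha> / d * (\<Sum>k<d. \<Sum>m<d. (y k m)\<^sup>2) + \<beta> * (\<Sum>k<d. (y k k)\<^sup>2)"
    for y :: "nat \<Rightarrow> nat \<Rightarrow> real"
  proof -
    have "(\<Sum>i<d. of_bool (i = m) * y k i) = y k m" if "m < d" for k m
      using that by (simp add: of_bool_def if_distrib[of "\<lambda>z. z * _"] cong: if_cong)
    then show ?thesis
      using positive_id_tensor_PhiD[OF pos, of "\<lambda>k i. of_bool (i = k)" y] by simp
  qed
  have diag_form: "0 \<le> (1 - \<alpha> - \<beta>) * (\<Sum>k<d. u k)\<^sup>2 + (\<alpha> / d + \<beta>) * (\<Sum>k<d. (u k)\<^sup>2)"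
    for u :: "nat \<Rightarrow> real"
  proof -
    have "(\<Sum>m<d. (if k = m then u k else 0)\<^sup>2) = (u k)\<^sup>2" if "k < d" for k
      using that by (simp add: if_distrib[of "\<lambda>z. z\<^sup>2"] cong: if_cong)
    then show ?thesis
      using form[of "\<lambda>k m. if k = m then u k else 0"] by (simp add: algebra_simps)
  qed
  show "0 \<le> \<alpha>"
    using form[of "\<lambda>k m. of_bool (k = 0 \<and> m = 1)"] d
    by (simp add: sum_eq_first_two zero_le_divide_iff del: sum_of_bool_eq)
  \<comment> \<open>A diagonal \<open>y\<close> of trace zero removes the first term; the identity,
    used afterwards, maximizes it relative to the sum of squares.\<close>
  have "0 \<le> 2 * (\<alpha> / d + \<beta>)"
    using diag_form[of "\<lambda>k. if k = 0 then 1 else if k = 1 then - 1 else 0"] d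
    by (simp add: sum_eq_first_two algebra_simps)
  then show "0 \<le> \<alpha> / d + \<beta>"
    by simp
  have "0 \<le> ((1 - \<alpha> - \<beta>) * d + \<alpha> / d + \<beta>) * d"
    using diag_form[of "\<lambda>_. 1"] d by (simp add: power2_eq_square algebra_simps)
  then show "0 \<le> (1 - \<alpha> - \<beta>) * d + \<alpha> / d + \<beta>"
    using d by (simp add: zero_le_mult_iff)
qed

text \<open>For every n, N \<ge> S reduces the claim to cP + (a + \<beta>)S \<ge> 0. If c < 0, then
  P \<le> dS reduces it further to (cd + a + \<beta>)S \<ge> 0.\<close>

lemma completely_positive_Phi_sufficient:
  assumes d: "2 \<le> d" and \<alpha>: "0 \<le> \<alpha>" and \<beta>: "0 \<le> \<alpha> / d + \<beta>"
    and max: "0 \<le> (1 - \<alpha> - \<beta>) * d + \<alpha> / d + \<beta>"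
  shows "completely_positive_map d (Phi d \<alpha> \<beta>)"
  unfolding completely_positive_map_def
proof (intro conjI allI impI linear_Phi positive_id_tensor_PhiI)
  fix n X and y :: "nat \<Rightarrow> nat \<Rightarrow> complex"
  assume X: "psd_mat (n * d) X"
  define P where "P = (\<Sum>k<d. \<Sum>l<d. slot_form n d X k l (y k) (y l))"
  define N where "N = (\<Sum>k<d. \<Sum>m<d. slot_form n d X m m (y k) (y k))"
  define S where "S = (\<Sum>k<d. slot_form n d X k k (y k) (y k))"
  have "0 \<le> P" using X unfolding P_def psd_mat_slot_iff by blast
  moreover have "0 \<le> S" unfolding S_def using psd_mat_one_slot[OF X] by (intro sum_nonneg) auto
  moreover have "P \<le> of_nat d * S" unfolding P_def S_def by (rule diag_form_ge_form[OF X])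
  moreover have "S \<le> N" unfolding S_def N_def by (rule diag_form_le_trace_form[OF X])
  ultimately have le: "0 \<le> Re P" "0 \<le> Re S" "Re P \<le> d * Re S" "Re S \<le> Re N"
    and im: "Im P = 0" "Im S = 0" "Im N = 0"
    by (auto simp: less_eq_complex_def)
  have "\<alpha> / d * Re S \<le> \<alpha> / d * Re N"
    using \<alpha> le by (intro mult_left_mono) auto
  moreover have "0 \<le> (1 - \<alpha> - \<beta>) * Re P + (\<alpha> / d + \<beta>) * Re S"
  proof (cases "0 \<le> 1 - \<alpha> - \<beta>")
    case True
    then show ?thesis using \<beta> le by simp
  next
    case False
    have "0 \<le> ((1 - \<alpha> - \<beta>) * d + \<alpha> / d + \<beta>) * Re S"
      using max le by simp
    moreover have "(1 - \<alpha> - \<beta>) * (d * Re S) \<le> (1 - \<alpha> - \<beta>) * Re P"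
      using False le by (intro mult_left_mono_neg) auto
    ultimately show ?thesis by (simp add: algebra_simps)
  qed
  ultimately have "0 \<le> (1 - \<alpha> - \<beta>) * Re P + \<alpha> / d * Re N + \<beta> * Re S"
    by (simp add: algebra_simps)
  then show "0 \<le> of_real (1 - \<alpha> - \<beta>) * (\<Sum>k<d. \<Sum>l<d. slot_form n d X k l (y k) (y l)) +
      of_real (\<alpha> / d) * (\<Sum>k<d. \<Sum>m<d. slot_form n d X m m (y k) (y k)) +
      of_real \<beta> * (\<Sum>k<d. slot_form n d X k k (y k) (y k))"
    using im unfolding less_eq_complex_def P_def[symmetric] N_def[symmetric] S_def[symmetric]
    by simp
qed

theorem proposition2p1:
  fixes d :: nat and \<alpha> \<beta> :: real
  assumes "d \<ge> 2"
  shows "(positive_map d (Phi d \<alpha> \<beta>) \<longleftrightarrow>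
            (0 \<le> \<alpha> \<and> \<alpha> \<le> real d / (real d - 1)) \<and>
            (- (2 * \<alpha> / real d) \<le> \<beta> \<and> \<beta> \<le> real d / (real d - 1) - \<alpha>)) \<and>
         (completely_positive_map d (Phi d \<alpha> \<beta>) \<longleftrightarrow>
            (0 \<le> \<alpha> \<and> \<alpha> \<le> real d / (real d - 1)) \<and>
            (- (\<alpha> / real d) \<le> \<beta> \<and>
             \<beta> \<le> real d / (real d - 1) - (real d + 1) / real d * \<alpha>))"
proof -
  have d: "1 < real d" using assms by simp
  \<comment> \<open>The stated bounds are the conditions of the preceding lemmas up to a positive
    factor built from d and d - 1.\<close>
  have top: "\<alpha> \<le> real d / (real d - 1) \<longleftrightarrow> 0 \<le> 1 - \<alpha> + \<alpha> / d"
    using d by (simp add: field_simps)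
  have flat: "\<beta> \<le> real d / (real d - 1) - \<alpha> \<longleftrightarrow> 0 \<le> 1 - \<alpha> - \<beta> + \<alpha> / d + \<beta> / d"
    using d by (simp add: field_simps)
  have max: "\<beta> \<le> real d / (real d - 1) - (real d + 1) / real d * \<alpha> \<longleftrightarrow>
      0 \<le> (1 - \<alpha> - \<beta>) * d + \<alpha> / d + \<beta>"
  proof -
    have "(1 - \<alpha> - \<beta>) * d + \<alpha> / d + \<beta> =
        (real d - 1) * (real d / (real d - 1) - (real d + 1) / real d * \<alpha> - \<beta>)"
      using d by (simp add: field_simps)
    then show ?thesis using d by (simp add: zero_le_mult_iff)
  qed
  \<comment> \<open>In the completely positive case the upper bound on \<alpha> comes from chaining
    the two bounds on \<beta>: the terms \<alpha>/d cancel.\<close>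
  have "\<alpha> \<le> real d / (real d - 1)"
    if "- (\<alpha> / real d) \<le> \<beta>" "\<beta> \<le> real d / (real d - 1) - (real d + 1) / real d * \<alpha>"
  proof -
    have "(real d + 1) / real d * \<alpha> = \<alpha> + \<alpha> / d" using d by (simp add: field_simps)
    with that show ?thesis by linarith
  qed
  with top flat max show ?thesis
    using positive_Phi_necessary[OF assms] positive_Phi_sufficient[OF assms]
      completely_positive_Phi_necessary[OF assms] completely_positive_Phi_sufficient[OF assms]
    by (smt (verit))
qed

end
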